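(* Let $N\ge3$, $p=\frac{N+2}{N-2}$ and $\lambda=\frac{N(N-2)}{4}$. Then the equation $$\Delta_{\mathbb{H}^N}u+\lambda u+u^p=0\qquad\text{in }\mathbb{H}^N\setminus\{Q\}$$ has an explicit positive radial singular solution $$U_s(r)=\left(\frac{N-2}{2\sinh r}\right)^{\frac{N-2}{2}}.$$ Moreover, the equation has a family of positive radial singular solutions $u_s$ satisfying $$0<\liminf_{r\to0^+}(\sinh r)^{\frac{N-2}{2}}u_s(r)<v_0<\limsup_{r\to0^+}(\sinh r)^{\frac{N-2}{2}}u_s(r)<\left(\frac{N(N-2)}{4}\right)^{\frac{N-2}{4}}$$ and $u_s(r)\sim\bar u_\infty e^{\frac{2-N}{2}r}$ as $r\to+\infty$ for some $\bar u_\infty>0$.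
   Context: $\mathbb{H}^N$ is the $N$-dimensional hyperbolic space (constant curvature $-1$), $\Delta_{\mathbb{H}^N}$ its Laplace–Beltrami operator, $Q\in\mathbb{H}^N$ a fixed point, and $r=d_{\mathbb{H}^N}(x,Q)$ the hyperbolic distance from $x$ to $Q$. "Radial" means depending only on $r$; for radial $u=u(r)$ the equation reads $$u''+(N-1)\coth r\,u'+\lambda u+u^p=0,\qquad r>0.$$ A function $u\in C^2((0,\infty))$ is called a positive radial singular solution if it solves this ODE, $u(r)>0$ for all $r>0$, and $u(r)\to+\infty$ as $r\to0^+$. Notation: $v_0=\left(\frac{N-2}{2}\right)^{(N-2)/2}$. The relation $f\sim g$ means $f/g\to1$. *)

theory Defs
  imports "HOL-Analysis.Analysis" "HOL-Library.Landau_Symbols"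
begin

unbundle asymp_equiv_syntax

definition coth :: "real \<Rightarrow> real" where
  "coth r = cosh r / sinh r"

definition C2_on :: "(real \<Rightarrow> real) \<Rightarrow> real set \<Rightarrow> bool" where
  "C2_on u S \<longleftrightarrow>
     u differentiable_on S \<and> deriv u differentiable_on S \<and> continuous_on S (deriv (deriv u))"

text \<open>
  A radial function on the hyperbolic space of dimension \<open>N\<close> (curvature \<open>-1\<close>) is represented by
  its profile \<open>u\<close>, a function of the hyperbolic distance \<open>r\<close> to the point \<open>Q\<close>; only the values
  \<open>u r\<close> with \<open>r > 0\<close> matter. The radial part of the Laplace--Beltrami operator is
  \<open>u'' + (N - 1) coth r u'\<close>, so the predicate below is the equation
  \<open>\<Delta> u + \<lambda> u + u\<^sup>p = 0\<close> away from \<open>Q\<close>.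
\<close>

definition radial_equation :: "nat \<Rightarrow> real \<Rightarrow> real \<Rightarrow> (real \<Rightarrow> real) \<Rightarrow> bool" where
  "radial_equation N lam p u \<longleftrightarrow>
     (\<forall>r>0. deriv (deriv u) r + (real N - 1) * coth r * deriv u r + lam * u r + u r powr p = 0)"

definition positive_radial_singular_solution ::
    "nat \<Rightarrow> real \<Rightarrow> real \<Rightarrow> (real \<Rightarrow> real) \<Rightarrow> bool" where
  "positive_radial_singular_solution N lam p u \<longleftrightarrow>
     C2_on u {0<..} \<and> radial_equation N lam p u \<and> (\<forall>r>0. u r > 0) \<and>
     filterlim u at_top (at_right 0)"

definition v0 :: "nat \<Rightarrow> real" where
  "v0 N = ((real N - 2) / 2) powr ((real N - 2) / 2)"

definition U_s :: "nat \<Rightarrow> real \<Rightarrow> real" where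
  "U_s N r = ((real N - 2) / (2 * sinh r)) powr ((real N - 2) / 2)"

end

theory Submission
  imports Defs "HOL-Real_Asymp.Real_Asymp"
begin

text \<open>
  The exponent is critical and \<open>lam\<close> is the curvature term of the conformal Laplacian, so the equation
  is conformally invariant. Punctured hyperbolic space is conformal to the half-cylinder over a sphere,
  and with \<open>m = (N - 2) / 2\<close>, \<open>t = - ln (tanh (r / 2))\<close> and \<open>u r = sinh r powr (- m) * v t\<close> the
  equation becomes the autonomous one \<open>v'' = m\<^sup>2 v - v powr p\<close> on \<open>t > 0\<close>
  (\<open>conformal_lift_solves_radial_equation\<close>). The singularity \<open>r = 0\<close> lies at \<open>t = \<infinity>\<close>, and \<open>r = \<infinity>\<close> is
  the regular point \<open>t = 0\<close>, which gives the decay \<open>exp (- m r)\<close>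
  (\<open>conformal_lift_asymp_equiv\<close>).

  The autonomous equation is Newton's equation in a potential well with its bottom at \<open>v0 = m powr m\<close>;
  the equilibrium is \<open>U_s\<close>. An orbit of negative energy oscillates forever between two turning points
  \<open>0 < \<alpha> < v0 < \<beta>\<close>, and \<open>\<beta>\<close> is smaller than the amplitude \<open>(m (m + 1)) powr (m / 2)\<close> of the orbit of
  energy zero (\<open>fowler_oscillation\<close>). The turning points are the lower and the upper limit of
  \<open>sinh r powr m * u r\<close> as \<open>r \<rightarrow> 0\<close>, and every \<open>\<beta>\<close> in the allowed range occurs; this is the family.

  The orbits come from two general results: the Picard theorem on a half-line for globally
  Lipschitz vector fields (\<open>global_lipschitz_ode\<close>), and the recurrence of both turning points for a
  conservative oscillator (\<open>potential_well_oscillation\<close>), which follows from conservation of energy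
  and a concavity argument, without any formula for the period.
\<close>

section \<open>Global solutions of Lipschitz differential equations\<close>

lemma at_within_atLeast_interior:
  fixes t :: real
  assumes "t > a"
  shows "at t within {a..} = at t"
  using assms by (intro at_within_interior) (simp add: interior_real_atLeast)

lemma has_integral_exp_scale:
  fixes L t :: real assumes "L > 0" "t \<ge> 0"
  shows "((\<lambda>s. exp (L * s)) has_integral (exp (L * t) - 1) / L) {0..t}"
proof -
  have "((\<lambda>s. exp (L * s)) has_integral (exp (L * t) / L - exp (L * 0) / L)) {0..t}"
    by (rule fundamental_theorem_of_calculus)
       (use assms in \<open>auto intro!: derivative_eq_intros simp flip: has_real_derivative_iff_has_vector_derivative\<close>)
  then show ?thesis by (simp add: diff_divide_distrib)
qed

text \<open>
  Picard iteration in an exponentially weighted norm. Writing the unknown as \<open>x t = exp (L t) w t\<close>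
  with \<open>w\<close> bounded and continuous turns the integral equation into a fixed-point problem for \<open>w\<close>.
  The weight makes the integral operator have Lipschitz constant \<open>K / L\<close> on the whole half-line at
  once, so that a large \<open>L\<close> gives the global solution directly, with no continuation of local
  solutions. It also absorbs the at most exponential growth of solutions of \<open>x' = F x\<close>.
\<close>

theorem global_lipschitz_ode:
  fixes F :: "'a::banach \<Rightarrow> 'a" and x0 :: 'a
  assumes lip: "K-lipschitz_on UNIV F"
  obtains x where "x 0 = x0"
    and "\<And>t. t \<ge> 0 \<Longrightarrow> (x has_vector_derivative F (x t)) (at t within {0..})"
proof -
  \<comment> \<open>Any \<open>L\<close> above \<open>K\<close> gives a contraction; this one has factor at most \<open>1/2\<close>, even for \<open>K = 0\<close>.\<close>
  define L where "L = 2 * K + 2"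
  have K: "K \<ge> 0" using lip by (rule lipschitz_on_nonneg)
  have L: "L > 0" "K / L \<le> 1/2" "L \<ge> 1" using K by (auto simp: L_def field_simps)
  have contF: "continuous_on A F" for A
    using lipschitz_on_continuous_on[OF lip] continuous_on_subset by blast
  have growth: "norm (F y) \<le> norm (F 0) + K * norm y" for y
  proof -
    have "norm (F y - F 0) \<le> K * norm (y - 0)"
      using lipschitz_onD[OF lip, of y 0] by (simp add: dist_norm)
    then show ?thesis using norm_triangle_sub[of "F y" "F 0"] by simp
  qed
  define I where "I w t = integral {0..t} (\<lambda>s. F (exp (L * s) *\<^sub>R apply_bcontfun w s))"
    for w :: "real \<Rightarrow>\<^sub>C 'a" and t
  \<comment> \<open>The absolute value extends \<open>P w\<close> evenly to the whole line, the domain of the functions in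
    the complete space \<open>real \<Rightarrow>\<^sub>C 'a\<close>.\<close>
  define P where "P w t = exp (- L * \<bar>t\<bar>) *\<^sub>R (x0 + I w \<bar>t\<bar>)" for w :: "real \<Rightarrow>\<^sub>C 'a" and t
  have cont: "continuous_on A (\<lambda>s. F (exp (L * s) *\<^sub>R apply_bcontfun w s))" for w A
    by (rule continuous_on_compose2[OF contF[of UNIV]]) (auto intro!: continuous_intros)
  have int: "(\<lambda>s. F (exp (L * s) *\<^sub>R apply_bcontfun w s)) integrable_on {0..t}" for w t
    by (intro integrable_continuous_interval cont)
  have der: "(I w has_vector_derivative F (exp (L * t) *\<^sub>R apply_bcontfun w t)) (at t within {0..})"
    if "t \<ge> 0" for w t
  proof -
    have "(I w has_vector_derivative F (exp (L * t) *\<^sub>R apply_bcontfun w t)) (at t within {0..t+1})"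
      unfolding I_def by (rule integral_has_vector_derivative[OF cont]) (use that in auto)
    moreover have "at t within {0..t+1} = at t within {0..}"
      by (rule at_within_nhd[of _ "{..<t+1}"]) (use that in auto)
    ultimately show ?thesis by simp
  qed
  have contI: "continuous_on {0..} (I w)" for w
    by (rule continuous_on_vector_derivative) (use der in auto)
  have contP: "continuous_on UNIV (P w)" for w
    unfolding P_def
    by (intro continuous_intros continuous_on_compose2[OF contI[of w]]) auto
  have expint: "((\<lambda>s. exp (L * s)) has_integral (exp (L * t) - 1) / L) {0..t}" if "t \<ge> 0" for t
    using has_integral_exp_scale L that by blast
  have bdd: "norm (P w t) \<le> norm x0 + (norm (F 0) + K * norm w) / L" for w t
  proof -
    define s where "s = \<bar>t\<bar>"
    have s: "s \<ge> 0" by (simp add: s_def)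
    define C where "C = norm (F 0) + K * norm w"
    have C: "C \<ge> 0" using K by (simp add: C_def)
    have "norm (I w s) \<le> integral {0..s} (\<lambda>r. C * exp (L * r))"
      unfolding I_def
    proof (rule integral_norm_bound_integral[OF int])
      show "(\<lambda>r. C * exp (L * r)) integrable_on {0..s}"
        by (intro integrable_continuous_interval continuous_intros)
      fix r assume r: "r \<in> {0..s}"
      have "norm (F (exp (L * r) *\<^sub>R apply_bcontfun w r)) \<le> norm (F 0) * 1 + K * (exp (L * r) * norm (apply_bcontfun w r))"
        using growth[of "exp (L * r) *\<^sub>R apply_bcontfun w r"] by simp
      also have "\<dots> \<le> norm (F 0) * exp (L * r) + K * (exp (L * r) * norm w)"
        by (intro add_mono mult_left_mono norm_bounded) (use r L K in auto)
      finally show "norm (F (exp (L * r) *\<^sub>R apply_bcontfun w r)) \<le> C * exp (L * r)"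
        by (simp add: C_def algebra_simps)
    qed
    also have "\<dots> = C * ((exp (L * s) - 1) / L)"
      by (rule integral_unique[OF has_integral_mult_right[OF expint[OF s]]])
    also have "\<dots> \<le> C / L * exp (L * s)" using C L by (simp add: field_simps)
    finally have "norm (x0 + I w s) \<le> norm x0 * exp (L * s) + C / L * exp (L * s)"
      using L s by (intro order_trans[OF norm_triangle_ineq] add_mono) (auto simp: mult_le_cancel_left1)
    then have "exp (- (L * s)) * norm (x0 + I w s)
        \<le> exp (- (L * s)) * (norm x0 * exp (L * s) + C / L * exp (L * s))"
      by (rule mult_left_mono) simp
    also have "\<dots> = norm x0 + C / L" using L by (simp add: exp_minus field_simps)
    finally show ?thesis by (simp add: P_def s_def C_def)
  qed
  define T where "T w = Bcontfun (P w)" for w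
  have T: "apply_bcontfun (T w) = P w" for w
    unfolding T_def
    by (rule Bcontfun_inverse) (auto simp: bcontfun_def contP bounded_iff intro!: exI bdd)
  have contr: "dist (P w t) (P z t) \<le> 1/2 * dist w z" for w z t
  proof -
    define s where "s = \<bar>t\<bar>"
    have s: "s \<ge> 0" by (simp add: s_def)
    define D where "D = K * dist w z"
    have D: "D \<ge> 0" using K by (simp add: D_def)
    have "norm (I w s - I z s) = norm (integral {0..s} (\<lambda>r. F (exp (L * r) *\<^sub>R apply_bcontfun w r) - F (exp (L * r) *\<^sub>R apply_bcontfun z r)))"
      unfolding I_def by (subst integral_diff[OF int int]) simp
    also have "\<dots> \<le> integral {0..s} (\<lambda>r. D * exp (L * r))"
    proof (rule integral_norm_bound_integral)
      show "(\<lambda>r. D * exp (L * r)) integrable_on {0..s}"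
        by (intro integrable_continuous_interval continuous_intros)
      show "(\<lambda>r. F (exp (L * r) *\<^sub>R apply_bcontfun w r) - F (exp (L * r) *\<^sub>R apply_bcontfun z r)) integrable_on {0..s}"
        by (intro integrable_diff int)
      fix r assume r: "r \<in> {0..s}"
      have "norm (F (exp (L * r) *\<^sub>R apply_bcontfun w r) - F (exp (L * r) *\<^sub>R apply_bcontfun z r))
          \<le> K * dist (exp (L * r) *\<^sub>R apply_bcontfun w r) (exp (L * r) *\<^sub>R apply_bcontfun z r)"
        using lipschitz_onD[OF lip] by (simp add: dist_norm)
      also have "\<dots> = K * (exp (L * r) * dist (apply_bcontfun w r) (apply_bcontfun z r))"
        by (simp add: dist_norm flip: scaleR_right_diff_distrib)
      also have "\<dots> \<le> K * (exp (L * r) * dist w z)"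
        by (intro mult_left_mono dist_bounded) (use K in auto)
      finally show "norm (F (exp (L * r) *\<^sub>R apply_bcontfun w r) - F (exp (L * r) *\<^sub>R apply_bcontfun z r)) \<le> D * exp (L * r)"
        by (simp add: D_def algebra_simps)
    qed
    also have "\<dots> = D * ((exp (L * s) - 1) / L)"
      by (rule integral_unique[OF has_integral_mult_right[OF expint[OF s]]])
    also have "\<dots> \<le> D / L * exp (L * s)" using D L by (simp add: field_simps)
    finally have "exp (- (L * s)) * norm (I w s - I z s) \<le> exp (- (L * s)) * (D / L * exp (L * s))"
      by (rule mult_left_mono) simp
    also have "\<dots> = K / L * dist w z" using L by (simp add: exp_minus D_def field_simps)
    also have "\<dots> \<le> 1/2 * dist w z" using L by (intro mult_right_mono) auto
    finally have "norm (exp (- (L * s)) *\<^sub>R (I w s - I z s)) \<le> 1/2 * dist w z" by simp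
    moreover have "P w t - P z t = exp (- (L * s)) *\<^sub>R (I w s - I z s)"
      by (simp add: P_def s_def algebra_simps)
    ultimately show ?thesis by (simp add: dist_norm)
  qed
  have "\<exists>!w. T w = w"
  proof (rule banach_fix_type)
    show "\<forall>w z. dist (T w) (T z) \<le> 1/2 * dist w z"
      by (intro allI dist_bound) (simp only: T contr)
  qed auto
  then obtain w where w: "T w = w" by auto
  define x where "x t = exp (L * t) *\<^sub>R apply_bcontfun w t" for t
  have x: "x t = x0 + I w t" if "t \<ge> 0" for t
    using that T[of w] unfolding w by (simp add: x_def P_def exp_minus)
  show ?thesis
  proof (rule that[of x])
    show "x 0 = x0" by (simp add: x I_def)
    fix t :: real assume t: "t \<ge> 0"
    have "((\<lambda>t. x0 + I w t) has_vector_derivative F (x t)) (at t within {0..})"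
      using has_vector_derivative_add[OF has_vector_derivative_const der[OF t]] by (simp add: x_def)
    then show "(x has_vector_derivative F (x t)) (at t within {0..})"
      by (rule has_vector_derivative_transform[rotated 2]) (use t x in auto)
  qed
qed

section \<open>Oscillation in a potential well\<close>

text \<open>
  A trajectory that stayed above \<open>c\<close> would be concave and bounded, hence nondecreasing. Not being at
  rest at \<open>c\<close>, it would get strictly above \<open>c\<close> at some time and stay there, where compactness bounds
  the restoring force away from zero; then the velocity would tend to \<open>- \<infinity>\<close>.
\<close>

lemma falls_below_equilibrium:
  fixes v v' f :: "real \<Rightarrow> real"
  assumes dv: "\<And>t. t > 0 \<Longrightarrow> (v has_real_derivative v' t) (at t)"
    and dv': "\<And>t. t > 0 \<Longrightarrow> (v' has_real_derivative f (v t)) (at t)"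
    and ub: "\<And>t. t > 0 \<Longrightarrow> v t \<le> b"
    and cont: "continuous_on {c..b} f"
    and neg: "\<And>x. c < x \<Longrightarrow> x \<le> b \<Longrightarrow> f x < 0" and eq: "f c = 0"
    and not_rest: "\<And>t. t > 0 \<Longrightarrow> v t = c \<Longrightarrow> v' t \<noteq> 0"
    and T: "T > 0"
  shows "\<exists>t\<ge>T. v t < c"
proof (rule ccontr)
  assume "\<not> ?thesis"
  then have above: "v t \<ge> c" if "t \<ge> T" for t using that by force
  have fle: "f (v t) \<le> 0" if "t \<ge> T" for t
    using above[OF that] ub[of t] neg[of "v t"] eq that T by (cases "v t = c") (auto simp: less_le)
  have dec: "v' t \<le> v' s" if "T \<le> s" "s \<le> t" for s t
  proof (rule DERIV_nonpos_imp_nonincreasing[OF that(2)])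
    fix x assume "s \<le> x" "x \<le> t"
    then show "\<exists>y. (v' has_real_derivative y) (at x) \<and> y \<le> 0"
      using dv'[of x] fle[of x] that T by (intro exI[of _ "f (v x)"]) auto
  qed
  have v'nonneg: "v' s \<ge> 0" if s: "s \<ge> T" for s
  proof (rule ccontr)
    assume n: "\<not> v' s \<ge> 0"
    \<comment> \<open>The time at which the tangent line at \<open>s\<close>, which lies above the graph, reaches \<open>c - 1\<close>.\<close>
    define t where "t = s + (v s - c + 1) / (- v' s)"
    have st: "s < t" using n above[OF s] by (simp add: t_def divide_pos_neg)
    obtain z where z: "s < z" "z < t" "v t - v s = (t - s) * v' z"
      using MVT2[OF st, of v v'] dv s T by force
    have "v t - v s \<le> (t - s) * v' s"
      unfolding z(3) using dec[of s z] z s st by (intro mult_left_mono) auto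
    also have "\<dots> = - (v s - c + 1)" using n by (simp add: t_def field_simps)
    finally show False using above[of t] st s by simp
  qed
  have inc: "v s \<le> v t" if "T \<le> s" "s \<le> t" for s t
  proof (rule DERIV_nonneg_imp_nondecreasing[OF that(2)])
    fix x assume "s \<le> x" "x \<le> t"
    then show "\<exists>y. (v has_real_derivative y) (at x) \<and> y \<ge> 0"
      using dv[of x] v'nonneg[of x] that T by (intro exI[of _ "v' x"]) auto
  qed
  obtain T1 where T1: "T1 \<ge> T" "v T1 > c"
  proof (cases "v T = c")
    case True
    then have "v' T > 0" using not_rest[OF T] v'nonneg[of T] by simp
    then obtain d where d: "d > 0" "\<And>h. 0 < h \<Longrightarrow> h < d \<Longrightarrow> v T < v (T + h)"
      using DERIV_pos_inc_right[OF dv[OF T]] by blast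
    show ?thesis using that[of "T + d/2"] d(1) d(2)[of "d/2"] True by simp
  next
    case False
    then show ?thesis using that[of T] above[of T] by simp
  qed
  have ne: "{v T1..b} \<noteq> {}" using ub[of T1] T1 T by simp
  have "continuous_on {v T1..b} f" by (rule continuous_on_subset[OF cont]) (use T1 in auto)
  then obtain x where x: "x \<in> {v T1..b}" "\<And>y. y \<in> {v T1..b} \<Longrightarrow> f y \<le> f x"
    using continuous_attains_sup[OF compact_Icc ne] by blast
  have fx: "f x < 0" using x(1) T1 neg by simp
  \<comment> \<open>By this time the force bound \<open>f x\<close> has pushed the velocity down to at most \<open>-1\<close>.\<close>
  define t where "t = T1 + (v' T1 + 1) / (- f x)"
  have t: "T1 < t" using fx v'nonneg[OF T1(1)] by (simp add: t_def divide_pos_neg)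
  obtain z where z: "T1 < z" "z < t" "v' t - v' T1 = (t - T1) * f (v z)"
    using MVT2[OF t, of v' "\<lambda>s. f (v s)"] dv' T1 T by force
  have "f (v z) \<le> f x" using inc[of T1 z] ub[of z] z T1 T by (intro x(2)) simp
  then have "v' t - v' T1 \<le> (t - T1) * f x"
    unfolding z(3) using t by (intro mult_left_mono) auto
  also have "\<dots> = - (v' T1 + 1)" using fx by (simp add: t_def field_simps)
  finally show False using v'nonneg[of t] t T1 by simp
qed

lemma rises_above_equilibrium:
  fixes v v' f :: "real \<Rightarrow> real"
  assumes dv: "\<And>t. t > 0 \<Longrightarrow> (v has_real_derivative v' t) (at t)"
    and dv': "\<And>t. t > 0 \<Longrightarrow> (v' has_real_derivative f (v t)) (at t)"
    and lb: "\<And>t. t > 0 \<Longrightarrow> a \<le> v t"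
    and cont: "continuous_on {a..c} f"
    and pos: "\<And>x. a \<le> x \<Longrightarrow> x < c \<Longrightarrow> f x > 0" and eq: "f c = 0"
    and not_rest: "\<And>t. t > 0 \<Longrightarrow> v t = c \<Longrightarrow> v' t \<noteq> 0"
    and T: "T > 0"
  shows "\<exists>t\<ge>T. v t > c"
proof -
  have "\<exists>t\<ge>T. - v t < - c"
  proof (rule falls_below_equilibrium)
    show "continuous_on {- c..- a} (\<lambda>x. - f (- x))"
      by (intro continuous_intros continuous_on_compose2[OF cont]) auto
    show "((\<lambda>t. - v t) has_real_derivative - v' t) (at t)" if "t > 0" for t
      using dv[OF that] by (rule DERIV_minus)
    show "((\<lambda>t. - v' t) has_real_derivative - f (- (- v t))) (at t)" if "t > 0" for t
      using DERIV_minus[OF dv'[OF that]] by simp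
  qed (use lb pos[of "- x" for x] eq not_rest T in auto)
  then show ?thesis by auto
qed

lemma dist_clamp_le:
  fixes x y :: real
  shows "dist (max a (min b x)) (max a (min b y)) \<le> dist x y"
  unfolding dist_real_def by (auto simp: max_def min_def)

text \<open>
  Motion in a potential well, released at rest from the right end \<open>\<beta>\<close>. Clamping the argument of the
  force to \<open>{\<alpha>..\<beta>}\<close> makes it globally Lipschitz, so that a global trajectory exists. Its energy is
  conserved, and the potential of the clamped force exceeds the energy level \<open>W \<alpha> = W \<beta>\<close> outside
  \<open>{\<alpha>..\<beta>}\<close>; so the trajectory never leaves this interval and solves the original equation. The energy
  also shows that the only turning points are \<open>\<alpha>\<close> and \<open>\<beta>\<close>. Since the trajectory crosses \<open>c\<close>
  infinitely often in both directions, it has a minimum between two excursions above \<open>c\<close> and a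
  maximum between two excursions below; these are turning points, so both ends are reached at
  arbitrarily late times.
\<close>

theorem potential_well_oscillation:
  fixes f W :: "real \<Rightarrow> real"
  assumes ab: "\<alpha> < c" "c < \<beta>"
    and lip: "K-lipschitz_on {\<alpha>..\<beta>} f"
    and pos: "\<And>x. \<alpha> \<le> x \<Longrightarrow> x < c \<Longrightarrow> f x > 0"
    and neg: "\<And>x. c < x \<Longrightarrow> x \<le> \<beta> \<Longrightarrow> f x < 0"
    and eq: "f c = 0"
    and W: "\<And>x. x \<in> {\<alpha>..\<beta>} \<Longrightarrow> (W has_real_derivative - f x) (at x within {\<alpha>..\<beta>})"
    and level: "W \<alpha> = W \<beta>"
  obtains v v' where "v 0 = \<beta>"
    and "\<And>t. t \<ge> 0 \<Longrightarrow> (v has_real_derivative v' t) (at t within {0..})"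
    and "\<And>t. t \<ge> 0 \<Longrightarrow> (v' has_real_derivative f (v t)) (at t within {0..})"
    and "\<And>t. t \<ge> 0 \<Longrightarrow> v t \<in> {\<alpha>..\<beta>}"
    and "\<And>T. \<exists>t\<ge>T. v t = \<alpha>" and "\<And>T. \<exists>t\<ge>T. v t = \<beta>"
proof -
  define g where "g x = f (max \<alpha> (min \<beta> x))" for x
  have K: "K \<ge> 0" using lip by (rule lipschitz_on_nonneg)
  have g_lip: "dist (g x) (g y) \<le> K * dist x y" for x y
  proof -
    have "dist (g x) (g y) \<le> K * dist (max \<alpha> (min \<beta> x)) (max \<alpha> (min \<beta> y))"
      unfolding g_def by (rule lipschitz_onD[OF lip]) (use ab in auto)
    also have "\<dots> \<le> K * dist x y" by (intro mult_left_mono dist_clamp_le K)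
    finally show ?thesis .
  qed
  have gf: "g x = f x" if "x \<in> {\<alpha>..\<beta>}" for x using that by (simp add: g_def)
  have gpos: "g x > 0" if "x < c" for x
    using that ab by (auto simp: g_def intro!: pos)
  have gneg: "g x < 0" if "x > c" for x
    using that ab by (auto simp: g_def min_def max_def intro!: neg)
  have g_lip': "K-lipschitz_on UNIV g" using g_lip K by (intro lipschitz_onI) auto
  have contg: "continuous_on UNIV g" by (rule lipschitz_on_continuous_on[OF g_lip'])
  have F_lip: "(K + 1)-lipschitz_on UNIV (\<lambda>z :: real \<times> real. (snd z, g (fst z)))"
  proof (rule lipschitz_onI)
    fix z y :: "real \<times> real"
    have "dist (snd z, g (fst z)) (snd y, g (fst y)) \<le> dist (snd z) (snd y) + dist (g (fst z)) (g (fst y))"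
      unfolding dist_Pair_Pair by (rule sqrt_sum_squares_le_sum) auto
    also have "\<dots> \<le> dist z y + K * dist z y"
      by (rule add_mono[OF dist_snd_le order_trans[OF g_lip mult_left_mono[OF dist_fst_le K]]])
    finally show "dist (snd z, g (fst z)) (snd y, g (fst y)) \<le> (K + 1) * dist z y"
      by (simp add: algebra_simps)
  qed (use K in simp)
  obtain z where z0: "z 0 = (\<beta>, 0)"
    and dz: "\<And>t. t \<ge> 0 \<Longrightarrow> (z has_vector_derivative (snd (z t), g (fst (z t)))) (at t within {0..})"
    by (rule global_lipschitz_ode[OF F_lip, of "(\<beta>, 0)"]) (erule that, simp)
  define v v' where "v t = fst (z t)" and "v' t = snd (z t)" for t
  have dv: "(v has_real_derivative v' t) (at t within {0..})" if "t \<ge> 0" for t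
    using bounded_linear.has_vector_derivative[OF bounded_linear_fst dz[OF that]]
    by (simp add: v_def[abs_def] v'_def has_real_derivative_iff_has_vector_derivative)
  have dv': "(v' has_real_derivative g (v t)) (at t within {0..})" if "t \<ge> 0" for t
    using bounded_linear.has_vector_derivative[OF bounded_linear_snd dz[OF that]]
    by (simp add: v_def v'_def[abs_def] has_real_derivative_iff_has_vector_derivative)
  have init: "v 0 = \<beta>" "v' 0 = 0" by (simp_all add: v_def v'_def z0)
  \<comment> \<open>\<open>- G\<close> is the potential of the clamped force: up to a constant it is \<open>W\<close> on \<open>{\<alpha>..\<beta>}\<close>, and it
    continues \<open>W\<close> along its tangents outside.\<close>
  have "\<exists>G. \<forall>x. - \<infinity> < ereal x \<longrightarrow> ereal x < \<infinity> \<longrightarrow> (G has_vector_derivative g x) (at x)"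
    using contg by (intro einterval_antiderivative) (auto simp: continuous_on_eq_continuous_at)
  then obtain G where dG: "\<And>x. (G has_real_derivative g x) (at x)"
    by (auto simp: has_real_derivative_iff_has_vector_derivative)
  have energy: "(v' t)\<^sup>2 / 2 = G (v t) - G \<beta>" if "t \<ge> 0" for t
  proof -
    have "\<exists>C. \<forall>t\<in>{0..}. (v' t)\<^sup>2 / 2 - G (v t) = C"
    proof (rule has_field_derivative_zero_constant)
      show "((\<lambda>t. (v' t)\<^sup>2 / 2 - G (v t)) has_real_derivative 0) (at t within {0..})" if "t \<in> {0..}" for t
        by (rule derivative_eq_intros dv dv' DERIV_chain2[OF dG] refl | use that in simp)+
    qed auto
    then obtain C where C: "\<And>t. t \<ge> 0 \<Longrightarrow> (v' t)\<^sup>2 / 2 - G (v t) = C" by auto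
    show ?thesis using C[OF that] C[of 0] init by simp
  qed
  have Gab: "G \<alpha> = G \<beta>"
  proof -
    have "\<exists>C. \<forall>x\<in>{\<alpha>..\<beta>}. G x + W x = C"
    proof (rule has_field_derivative_zero_constant)
      show "((\<lambda>x. G x + W x) has_real_derivative 0) (at x within {\<alpha>..\<beta>})" if "x \<in> {\<alpha>..\<beta>}" for x
        using DERIV_add[OF has_field_derivative_at_within[OF dG[of x]] W[OF that]] gf[OF that] by simp
    qed auto
    then obtain C where C: "\<And>x. x \<in> {\<alpha>..\<beta>} \<Longrightarrow> G x + W x = C" by auto
    show ?thesis using C[of \<alpha>] C[of \<beta>] level ab by simp
  qed
  have G_inc: "G x < G y" if xy: "x < y" "y \<le> c" for x y
  proof -
    obtain \<xi> where "\<xi> > x" "\<xi> < y" "G y - G x = (y - x) * g \<xi>" using MVT2[OF xy(1), of G g] dG by auto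
    then show ?thesis using gpos[of \<xi>] xy by (smt (verit) mult_pos_pos)
  qed
  have G_dec: "G y < G x" if xy: "x < y" "c \<le> x" for x y
  proof -
    obtain \<xi> where "\<xi> > x" "\<xi> < y" "G y - G x = (y - x) * g \<xi>" using MVT2[OF xy(1), of G g] dG by auto
    then show ?thesis using gneg[of \<xi>] xy by (smt (verit) mult_pos_neg)
  qed
  have range: "v t \<in> {\<alpha>..\<beta>}" if "t \<ge> 0" for t
  proof -
    have "G (v t) \<ge> G \<beta>" using energy[OF that] by (smt (verit) zero_le_power2 divide_nonneg_pos)
    then show ?thesis using G_inc[of "v t" \<alpha>] G_dec[of \<beta> "v t"] Gab ab by fastforce
  qed
  have dv'f: "(v' has_real_derivative f (v t)) (at t within {0..})" if "t \<ge> 0" for t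
    using dv'[OF that] gf[OF range[OF that]] by simp
  have dv_at: "(v has_real_derivative v' t) (at t)" if "t > 0" for t
    using dv[of t] at_within_atLeast_interior[OF that] that by simp
  have dv'_at: "(v' has_real_derivative f (v t)) (at t)" if "t > 0" for t
    using dv'f[of t] at_within_atLeast_interior[OF that] that by simp
  have not_rest: "v' t \<noteq> 0" if "t > 0" "v t = c" for t
    using energy[of t] G_dec[of c \<beta>] that ab by auto
  have contf: "continuous_on A f" if "A \<subseteq> {\<alpha>..\<beta>}" for A
    using lipschitz_on_continuous_on[OF lip] continuous_on_subset that by blast
  have below: "\<exists>t\<ge>T. v t < c" if "T > 0" for T
    by (rule falls_below_equilibrium[where f = f, OF dv_at dv'_at _ contf neg eq not_rest that])
       (use range ab in auto)
  have above: "\<exists>t\<ge>T. v t > c" if "T > 0" for T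
    by (rule rises_above_equilibrium[where f = f, OF dv_at dv'_at _ contf pos eq not_rest that])
       (use range ab in auto)
  have contv: "continuous_on {s..t} v" if "s > 0" for s t
    using that by (intro continuous_at_imp_continuous_on ballI DERIV_isCont[OF dv_at]) auto
  have turn: "v t = \<alpha> \<or> v t = \<beta>" if "t > 0" "v' t = 0" for t
  proof -
    have "G (v t) = G \<beta>" using energy[of t] that by simp
    then show ?thesis
      using G_inc[of \<alpha> "v t"] G_dec[of "v t" \<beta>] Gab range[of t] that by fastforce
  qed
  have hits: "\<exists>t\<ge>T. v t = \<alpha>" "\<exists>t\<ge>T. v t = \<beta>" for T
  proof -
    have "\<bar>T\<bar> + 1 > 0" by simp
    from above[OF this] obtain t1 where t1: "t1 \<ge> \<bar>T\<bar> + 1" "v t1 > c" by blast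
    then have "t1 > 0" by simp
    from below[OF this] obtain t2 where t2: "t2 \<ge> t1" "v t2 < c" by blast
    with \<open>t1 > 0\<close> have "t2 > 0" by simp
    from above[OF this] obtain t3 where t3: "t3 \<ge> t2" "v t3 > c" by blast
    with \<open>t2 > 0\<close> have "t3 > 0" by simp
    from below[OF this] obtain t4 where t4: "t4 \<ge> t3" "v t4 < c" by blast
    have "\<exists>s\<in>{t1..t3}. \<forall>y\<in>{t1..t3}. v s \<le> v y"
      by (rule continuous_attains_inf) (use contv t1 t2 t3 in auto)
    then obtain s where s: "s \<in> {t1..t3}" "\<And>y. y \<in> {t1..t3} \<Longrightarrow> v s \<le> v y" by blast
    have sc: "v s < c" using s(2)[of t2] t2 t3 by simp
    then have "s \<noteq> t1" "s \<noteq> t3" using t1 t3 by auto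
    then have d: "min (s - t1) (t3 - s) > 0" using s(1) by simp
    have "v' s = 0"
    proof (rule DERIV_local_min[OF dv_at d])
      show "\<forall>y. \<bar>s - y\<bar> < min (s - t1) (t3 - s) \<longrightarrow> v s \<le> v y"
        by (auto simp: abs_less_iff intro!: s(2))
    qed (use s(1) t1 in auto)
    then have "v s = \<alpha>" using turn[of s] sc s t1 ab by auto
    then show "\<exists>t\<ge>T. v t = \<alpha>" using s(1) t1 by (intro exI[of _ s]) auto
    have "\<exists>s\<in>{t2..t4}. \<forall>y\<in>{t2..t4}. v y \<le> v s"
      by (rule continuous_attains_sup) (use contv t1 t2 t3 t4 in auto)
    then obtain q where q: "q \<in> {t2..t4}" "\<And>y. y \<in> {t2..t4} \<Longrightarrow> v y \<le> v q" by blast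
    have qc: "v q > c" using q(2)[of t3] t3 t4 by simp
    then have "q \<noteq> t2" "q \<noteq> t4" using t2 t4 by auto
    then have d: "min (q - t2) (t4 - q) > 0" using q(1) by simp
    have "v' q = 0"
    proof (rule DERIV_local_max[OF dv_at d])
      show "\<forall>y. \<bar>q - y\<bar> < min (q - t2) (t4 - q) \<longrightarrow> v y \<le> v q"
        by (auto simp: abs_less_iff intro!: q(2))
    qed (use q(1) t1 t2 in auto)
    then have "v q = \<beta>" using turn[of q] qc q t1 t2 ab by auto
    then show "\<exists>t\<ge>T. v t = \<beta>" using q(1) t1 t2 by (intro exI[of _ q]) auto
  qed
  show ?thesis by (rule that[OF init(1) dv dv'f range hits])
qed

section \<open>The conformal change to the cylinder\<close>

text \<open>
  Up to sign this is the conformal coordinate: \<open>dr\<^sup>2 + sinh\<^sup>2 r d\<theta>\<^sup>2 = sinh\<^sup>2 r (dt\<^sup>2 + d\<theta>\<^sup>2)\<close> with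
  \<open>t = cyl r\<close>. The sign is chosen so that the singularity \<open>r = 0\<close> lies at \<open>t = \<infinity>\<close> and infinity at
  \<open>t = 0\<close>.
\<close>

definition cyl :: "real \<Rightarrow> real" where
  "cyl r = - ln (tanh (r / 2))"

lemma cyl_pos: "r > 0 \<Longrightarrow> cyl r > 0"
  unfolding cyl_def using ln_less_zero[of "tanh (r / 2)"] tanh_real_lt_1[of "r / 2"] by simp

text \<open>
  That \<open>cyl\<close> is an involution lets every statement about \<open>r \<rightarrow> 0\<close> be pulled back to \<open>t \<rightarrow> \<infinity>\<close> from
  the behaviour of \<open>cyl\<close> at infinity alone.
\<close>

lemma cyl_cyl:
  assumes "r > 0" shows "cyl (cyl r) = r"
proof -
  define x where "x = tanh (r / 2)"
  have x: "x > 0" using assms by (simp add: x_def)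
  have xr: "x = (1 - exp (- r)) / (1 + exp (- r))" by (simp add: x_def tanh_real_altdef)
  have e: "1 + exp (- r) \<noteq> (0::real)" by (smt (verit) exp_gt_zero)
  have "tanh (cyl r / 2) = (1 - x) / (1 + x)"
    using x tanh_real_altdef[of "- ln x / 2"] by (simp add: cyl_def flip: x_def)
  also have "\<dots> = exp (- r)" unfolding xr using e by (simp add: field_simps)
  finally show ?thesis by (simp add: cyl_def[of "cyl r"])
qed

lemma cyl_has_real_derivative:
  assumes "r > 0" shows "(cyl has_real_derivative - 1 / sinh r) (at r)"
proof -
  have s: "sinh r = 2 * sinh (r / 2) * cosh (r / 2)" using sinh_double[of "r / 2"] by simp
  have c: "cosh (r / 2) \<noteq> 0" "sinh (r / 2) \<noteq> 0" using assms by auto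
  have "(cyl has_real_derivative - ((1 - (tanh (r / 2))\<^sup>2) * (1 / 2) / tanh (r / 2))) (at r)"
    unfolding cyl_def[abs_def]
    by (rule derivative_eq_intros refl | use assms c in simp)+
  moreover have "1 - (tanh (r / 2))\<^sup>2 = ((cosh (r / 2))\<^sup>2 - (sinh (r / 2))\<^sup>2) / (cosh (r / 2))\<^sup>2"
    using c by (simp add: tanh_def power_divide diff_divide_distrib)
  then have "1 - (tanh (r / 2))\<^sup>2 = 1 / (cosh (r / 2))\<^sup>2"
    by (simp only: hyperbolic_pythagoras)
  then have "- ((1 - (tanh (r / 2))\<^sup>2) * (1 / 2) / tanh (r / 2)) = - 1 / sinh r"
    using c by (simp add: s tanh_def power2_eq_square)
  ultimately show ?thesis by simp
qed

lemma filterlim_cyl_at_top: "filterlim cyl (at_right 0) at_top"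
proof -
  have "((\<lambda>r. tanh (r / 2)) \<longlongrightarrow> (1::real)) at_top"
    by (rule filterlim_compose[OF tanh_real_at_top]) real_asymp
  from tendsto_minus[OF tendsto_ln[OF this]] have "(cyl \<longlongrightarrow> 0) at_top"
    unfolding cyl_def[abs_def] by simp
  moreover have "\<forall>\<^sub>F r in at_top. cyl r > 0"
    using eventually_gt_at_top[of 0] by eventually_elim (rule cyl_pos)
  ultimately show ?thesis by (rule tendsto_imp_filterlim_at_right)
qed

text \<open>
  The factor \<open>sinh r powr (- m)\<close> with \<open>m = (N - 2) / 2\<close> is the one under which the conformal Laplacian
  of the cylinder becomes that of hyperbolic space.
\<close>

definition conformal_lift :: "real \<Rightarrow> (real \<Rightarrow> real) \<Rightarrow> real \<Rightarrow> real" where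
  "conformal_lift m v r = sinh r powr (- m) * v (cyl r)"

lemma sinh_powr_times_conformal_lift: "r > 0 \<Longrightarrow> sinh r powr m * conformal_lift m v r = v (cyl r)"
  by (simp add: conformal_lift_def powr_minus field_simps)

lemma frequently_cyl:
  assumes "\<And>T. \<exists>t\<ge>T. P t"
  shows "\<exists>\<^sub>F r in at_right 0. P (cyl r)"
  unfolding frequently_def
proof
  assume "\<forall>\<^sub>F r in at_right 0. \<not> P (cyl r)"
  then have "\<forall>\<^sub>F t in at_top. \<not> P (cyl (cyl t))"
    using filterlim_cyl_at_top by (rule eventually_compose_filterlim)
  then have "\<forall>\<^sub>F t in at_top. \<not> P t"
    using eventually_gt_at_top[of 0] by eventually_elim (simp add: cyl_cyl)
  then show False using assms by (auto simp: eventually_at_top_linorder)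
qed

text \<open>
  Infinity corresponds to the regular point \<open>t = 0\<close> of the cylinder, where \<open>v\<close> simply has a limit; the
  decay comes from the conformal factor alone, since \<open>2 sinh r\<close> is asymptotic to \<open>exp r\<close>.
\<close>

lemma conformal_lift_asymp_equiv:
  assumes lim: "(v \<longlongrightarrow> l) (at_right 0)" and l: "l > 0"
  shows "conformal_lift m v \<sim>[at_top] (\<lambda>r. (2 powr m * l) * exp (- m * r))"
proof (rule asymp_equivI')
  have "((\<lambda>r. (1 - exp (- 2 * r)) powr (- m) * (v (cyl r) / l)) \<longlongrightarrow> (1 - 0) powr (- m) * (l / l)) at_top"
  proof (intro tendsto_intros filterlim_compose[OF lim filterlim_cyl_at_top])
    show "((\<lambda>r. exp (- 2 * r)) \<longlongrightarrow> (0::real)) at_top" by real_asymp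
  qed (use l in auto)
  then have "((\<lambda>r. (1 - exp (- 2 * r)) powr (- m) * (v (cyl r) / l)) \<longlongrightarrow> 1) at_top"
    using l by simp
  then show "((\<lambda>r. conformal_lift m v r / (2 powr m * l * exp (- m * r))) \<longlongrightarrow> 1) at_top"
  proof (rule Lim_transform_eventually)
    show "\<forall>\<^sub>F r in at_top. (1 - exp (- 2 * r)) powr (- m) * (v (cyl r) / l)
        = conformal_lift m v r / (2 powr m * l * exp (- m * r))"
      using eventually_gt_at_top[of 0]
    proof eventually_elim
      case (elim r)
      have "1 - exp (- 2 * r) = 2 * sinh r * exp (- r)"
        by (simp add: sinh_def field_simps flip: exp_add)
      then have "(1 - exp (- 2 * r)) powr (- m) = (2 * sinh r * exp (- r)) powr (- m)" by simp
      also have "\<dots> = inverse (2 powr m) * sinh r powr (- m) * inverse (exp (- m * r))"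
        using elim by (simp add: powr_mult powr_minus) (simp add: powr_def)
      finally show ?case
        by (simp add: conformal_lift_def divide_inverse)
    qed
  qed
qed

text \<open>
  Substituting the lift into the radial equation, the terms with \<open>v'\<close> cancel because \<open>N - 1 = 2 m + 1\<close>,
  the terms with \<open>v\<close> combine to \<open>- m\<^sup>2 v\<close> because \<open>lam = m (m + 1)\<close> and \<open>cosh\<^sup>2 - sinh\<^sup>2 = 1\<close>, and the
  nonlinear term acquires the same power of \<open>sinh r\<close> because \<open>m p = m + 2\<close>. What remains is
  \<open>v'' = m\<^sup>2 v - v powr p\<close>. A positive lower bound on \<open>v\<close> makes the conformal factor force the
  singularity.
\<close>

theorem conformal_lift_solves_radial_equation:
  fixes m :: real
  assumes m: "m > 0" and N: "real N = 2 * m + 2" and p: "p = 1 + 2 / m" and lam: "lam = m * (m + 1)"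
    and dv: "\<And>t. t > 0 \<Longrightarrow> (v has_real_derivative v' t) (at t)"
    and dv': "\<And>t. t > 0 \<Longrightarrow> (v' has_real_derivative m\<^sup>2 * v t - v t powr p) (at t)"
    and lower: "\<epsilon> > 0" "\<And>t. t > 0 \<Longrightarrow> v t \<ge> \<epsilon>"
  shows "positive_radial_singular_solution N lam p (conformal_lift m v)"
proof -
  define u where "u = conformal_lift m v"
  define u1 where "u1 r = sinh r powr (- m - 1) * (- m * cosh r * v (cyl r) - v' (cyl r))" for r
  define u2 where "u2 r = - ((real N - 1) * coth r * u1 r + lam * u r + u r powr p)" for r
  have vpos: "v (cyl r) > 0" if "r > 0" for r
    using lower(1) lower(2)[OF cyl_pos[OF that]] by linarith
  have du: "(u has_real_derivative u1 r) (at r)" if r: "r > 0" for r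
  proof -
    have s: "sinh r > 0" using r by simp
    have "(u has_real_derivative
        (- m * sinh r powr (- m - 1) * cosh r) * v (cyl r)
        + (v' (cyl r) * (- 1 / sinh r)) * sinh r powr (- m)) (at r)"
      unfolding u_def conformal_lift_def[abs_def]
      by (intro DERIV_mult DERIV_chain2[OF dv[OF cyl_pos[OF r]] cyl_has_real_derivative[OF r]])
         (use s in \<open>auto intro!: derivative_eq_intros\<close>)
    also have "sinh r powr (- m) = sinh r powr (- m - 1) * sinh r"
      using s by (simp add: powr_diff)
    finally show ?thesis using s by (simp add: u1_def algebra_simps)
  qed
  have du1: "(u1 has_real_derivative u2 r) (at r)" if r: "r > 0" for r
  proof -
    have s: "sinh r > 0" using r by simp
    let ?v = "v (cyl r)" and ?v' = "v' (cyl r)" and ?y = "sinh r powr (- m - 2)"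
    have "(u1 has_real_derivative
        ((- m - 1) * sinh r powr (- m - 1 - 1) * cosh r) * (- m * cosh r * ?v - ?v')
        + ((- m * sinh r) * ?v + (?v' * (- 1 / sinh r)) * (- m * cosh r)
            - (m\<^sup>2 * ?v - ?v powr p) * (- 1 / sinh r)) * sinh r powr (- m - 1)) (at r)"
      unfolding u1_def[abs_def]
      by (intro DERIV_mult DERIV_diff DERIV_chain2[OF dv[OF cyl_pos[OF r]] cyl_has_real_derivative[OF r]]
            DERIV_chain2[OF dv'[OF cyl_pos[OF r]] cyl_has_real_derivative[OF r]])
         (use s in \<open>auto intro!: derivative_eq_intros\<close>)
    also have "((- m - 1) * sinh r powr (- m - 1 - 1) * cosh r) * (- m * cosh r * ?v - ?v')
        + ((- m * sinh r) * ?v + (?v' * (- 1 / sinh r)) * (- m * cosh r)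
            - (m\<^sup>2 * ?v - ?v powr p) * (- 1 / sinh r)) * sinh r powr (- m - 1) = u2 r"
    proof -
      \<comment> \<open>With every power of \<open>sinh r\<close> written as \<open>sinh r powr (- m - 2)\<close> times a natural power,
        the claim is a polynomial identity modulo \<open>cosh\<^sup>2 = sinh\<^sup>2 + 1\<close>.\<close>
      have y: "sinh r powr (- m - 1 - 1) = ?y" by (simp add: algebra_simps)
      have y1: "sinh r powr (- m - 1) = ?y * sinh r" using s by (simp add: powr_diff powr_numeral power2_eq_square)
      have y2: "sinh r powr (- m) = ?y * (sinh r)\<^sup>2" using s by (simp add: powr_diff powr_numeral)
      have "- m * p = - m - 2" using m by (simp add: p field_simps)
      then have up: "u r powr p = ?y * ?v powr p"
        using s vpos[OF r] by (simp add: u_def conformal_lift_def powr_mult powr_powr)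
      have c2: "(cosh r)\<^sup>2 = (sinh r)\<^sup>2 + 1" by (simp add: cosh_square_eq)
      show ?thesis
        unfolding u2_def up unfolding u1_def u_def conformal_lift_def y y1 y2 N lam coth_def
        using s c2 by (simp add: field_simps) algebra
    qed
    finally show ?thesis .
  qed
  have deriv_u: "deriv u r = u1 r" if "r > 0" for r using du[OF that] by (rule DERIV_imp_deriv)
  have ddu: "(deriv u has_real_derivative u2 r) (at r)" if r: "r > 0" for r
    by (rule has_field_derivative_transform_within_open[OF du1[OF r], of "{0<..}"])
       (use r deriv_u in auto)
  have deriv_u2: "deriv (deriv u) r = u2 r" if "r > 0" for r using ddu[OF that] by (rule DERIV_imp_deriv)
  have upos: "u r > 0" if "r > 0" for r
    using vpos[OF that] that by (simp add: u_def conformal_lift_def)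
  have contu: "continuous_on {0<..} u" "continuous_on {0<..} u1"
    using du du1 by (auto intro!: continuous_at_imp_continuous_on DERIV_isCont)
  \<comment> \<open>The equation itself expresses the second derivative through continuous quantities.\<close>
  have "continuous_on {0<..} u2"
    unfolding u2_def[abs_def] coth_def using upos
    by (intro continuous_intros contu) (auto simp: less_imp_neq[symmetric])
  then have "continuous_on {0<..} (deriv (deriv u))"
    by (subst continuous_on_cong[OF refl deriv_u2]) auto
  moreover have "u differentiable_on {0<..}" "deriv u differentiable_on {0<..}"
    unfolding differentiable_on_def
    using du ddu by (meson differentiable_at_withinI greaterThan_iff real_differentiable_def)+
  moreover have "radial_equation N lam p u"
    unfolding radial_equation_def by (auto simp: deriv_u deriv_u2 u2_def)
  moreover have "filterlim u at_top (at_right 0)"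
  proof (rule filterlim_at_top_mono)
    show "filterlim (\<lambda>r. \<epsilon> * sinh r powr (- m)) at_top (at_right 0)"
      using m lower(1) by real_asymp
    have "\<forall>\<^sub>F r :: real in at_right 0. r > 0" by (rule eventually_at_right_less)
    then show "\<forall>\<^sub>F r in at_right 0. \<epsilon> * sinh r powr (- m) \<le> u r"
    proof eventually_elim
      case (elim r)
      then show ?case using lower(2)[OF cyl_pos[OF elim]]
        by (simp add: u_def conformal_lift_def mult.commute[of \<epsilon>] mult_left_mono)
    qed
  qed
  ultimately show ?thesis
    using upos by (simp add: positive_radial_singular_solution_def C2_on_def u_def)
qed

section \<open>Fowler orbits\<close>

text \<open>
  The force \<open>m\<^sup>2 x - x powr (1 + 2 / m)\<close> has the equilibrium \<open>m powr m\<close>, which is the bottom of the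
  potential \<open>W\<close>. The potential vanishes at \<open>0\<close> and at the upper bound on \<open>\<beta>\<close>, which is the amplitude
  of the homoclinic orbit. Between the equilibrium and this amplitude \<open>W \<beta>\<close> is negative, so
  the same level is attained at some \<open>\<alpha>\<close> below the equilibrium and, because \<open>W 0 = 0\<close>, above \<open>0\<close>:
  the orbit released at rest from \<open>\<beta>\<close> is confined to positive values.
\<close>

theorem fowler_oscillation:
  fixes m :: real
  assumes m: "m > 0"
    and \<beta>: "m powr m < \<beta>" "\<beta> < (m * (m + 1)) powr (m / 2)"
  obtains \<alpha> v v' where "0 < \<alpha>" "\<alpha> < m powr m" "v 0 = \<beta>"
    and "\<And>t. t \<ge> 0 \<Longrightarrow> (v has_real_derivative v' t) (at t within {0..})"
    and "\<And>t. t \<ge> 0 \<Longrightarrow> (v' has_real_derivative m\<^sup>2 * v t - v t powr (1 + 2 / m)) (at t within {0..})"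
    and "\<And>t. t \<ge> 0 \<Longrightarrow> v t \<in> {\<alpha>..\<beta>}"
    and "\<And>T. \<exists>t\<ge>T. v t = \<alpha>" and "\<And>T. \<exists>t\<ge>T. v t = \<beta>"
proof -
  define c where "c = m powr m"
  define f where "f x = m\<^sup>2 * x - x powr (1 + 2 / m)" for x
  define W where "W x = x powr (2 + 2 / m) / (2 + 2 / m) - m\<^sup>2 * x\<^sup>2 / 2" for x
  have c: "c > 0" "c < \<beta>" using m \<beta> by (auto simp: c_def)
  have c_eq: "c powr (2 / m) = m\<^sup>2" using m by (simp add: c_def powr_powr powr_numeral)
  \<comment> \<open>In this form the sign of the force is read off from the monotonicity of powers.\<close>
  have f_alt: "f x = x * (c powr (2 / m) - x powr (2 / m))" if "x > 0" for x
    using that by (simp add: f_def c_eq powr_add algebra_simps)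
  have pos: "f x > 0" if "0 < x" "x < c" for x
    unfolding f_alt[OF that(1)] using that m by (intro mult_pos_pos) (auto intro!: powr_less_mono2)
  have neg: "f x < 0" if "c < x" for x
  proof -
    have "x > 0" using that c by simp
    then show ?thesis unfolding f_alt[OF \<open>x > 0\<close>] using that c m
      by (intro mult_pos_neg) (auto intro!: powr_less_mono2)
  qed
  have eq: "f c = 0" using f_alt[OF c(1)] by simp
  have dW: "(W has_real_derivative - f x) (at x)" if "x > 0" for x
  proof -
    have "2 + 2 / m \<noteq> 0" using m by (smt (verit) divide_pos_pos)
    then show ?thesis
      unfolding W_def[abs_def] f_def using that
      by (auto intro!: derivative_eq_intros simp: add.commute)
  qed
  have W\<beta>: "W \<beta> < 0"
  proof -
    have "\<beta> powr (2 / m) < ((m * (m + 1)) powr (m / 2)) powr (2 / m)"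
      using m c \<beta> by (intro powr_less_mono2) auto
    also have "\<dots> = m * (m + 1)" using m by (simp add: powr_powr)
    finally have "\<beta> powr (2 / m) < m * (m + 1)" .
    moreover have "W \<beta> = \<beta>\<^sup>2 * m / (2 * (m + 1)) * (\<beta> powr (2 / m) - m * (m + 1))"
    proof -
      have "\<beta> powr (2 + 2 / m) = \<beta>\<^sup>2 * \<beta> powr (2 / m)"
        using c by (simp add: powr_add powr_numeral)
      moreover have "2 + 2 / m = 2 * (m + 1) / m" using m by (simp add: field_simps)
      ultimately show ?thesis using m unfolding W_def
        by (simp add: field_simps power2_eq_square)
    qed
    moreover have "\<beta>\<^sup>2 * m / (2 * (m + 1)) > 0" using m c by simp
    ultimately show ?thesis by (metis diff_less_0_iff_less mult_pos_neg)
  qed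
  have Wc: "W c < W \<beta>"
  proof -
    obtain x where "c < x" "x < \<beta>" "W \<beta> - W c = (\<beta> - c) * - f x"
      using MVT2[OF c(2), of W "\<lambda>x. - f x"] dW c by auto
    then show ?thesis using neg[of x] c by (smt (verit) mult_pos_pos)
  qed
  have expo: "2 + 2 / m > 0" using m by (simp add: add_pos_pos)
  have "continuous_on {0..c} W"
    unfolding W_def[abs_def] using expo
    by (intro continuous_on_diff continuous_on_divide continuous_on_powr') (auto intro!: continuous_intros)
  moreover have "W 0 = 0" by (simp add: W_def)
  ultimately obtain \<alpha> where \<alpha>: "0 \<le> \<alpha>" "\<alpha> \<le> c" "W \<alpha> = W \<beta>"
    using IVT2'[of W c "W \<beta>" 0] Wc W\<beta> c by auto
  then have \<alpha>': "0 < \<alpha>" "\<alpha> < c" using \<open>W 0 = 0\<close> W\<beta> Wc by (auto simp: less_le)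
  define K where "K = m\<^sup>2 + (1 + 2 / m) * \<beta> powr (2 / m)"
  have lip: "K-lipschitz_on {\<alpha>..\<beta>} f"
  proof (rule lipschitz_onI)
    show K: "K \<ge> 0" using m by (simp add: K_def)
    have "norm (f x - f y) \<le> K * norm (x - y)" if "x \<in> {\<alpha>..\<beta>}" "y \<in> {\<alpha>..\<beta>}" for x y
    proof (rule field_differentiable_bound[OF convex_real_interval(5) _ _ that(1) that(2)])
      fix z assume z: "z \<in> {\<alpha>..\<beta>}"
      then have z0: "z > 0" using \<alpha>' by simp
      show "(f has_real_derivative m\<^sup>2 - (1 + 2 / m) * z powr (2 / m)) (at z within {\<alpha>..\<beta>})"
        unfolding f_def[abs_def] using z0 by (auto intro!: derivative_eq_intros)
      have "z powr (2 / m) \<le> \<beta> powr (2 / m)" using z z0 m by (intro powr_mono2) auto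
      then have "(1 + 2 / m) * z powr (2 / m) \<le> (1 + 2 / m) * \<beta> powr (2 / m)"
        using m by (intro mult_left_mono) auto
      moreover have "(1 + 2 / m) * z powr (2 / m) \<ge> 0" using m by simp
      ultimately show "norm (m\<^sup>2 - (1 + 2 / m) * z powr (2 / m)) \<le> K"
        unfolding K_def real_norm_def using zero_le_power2[of m] by linarith
    qed
    then show "dist (f x) (f y) \<le> K * dist x y" if "x \<in> {\<alpha>..\<beta>}" "y \<in> {\<alpha>..\<beta>}" for x y
      using that by (simp add: dist_norm)
  qed
  show ?thesis
  proof (rule potential_well_oscillation[OF \<alpha>'(2) c(2) lip _ _ eq _ \<alpha>(3)])
    show "f x > 0" if "\<alpha> \<le> x" "x < c" for x using pos[of x] that \<alpha>' by simp
    show "f x < 0" if "c < x" for x using neg[OF that] .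
    show "(W has_real_derivative - f x) (at x within {\<alpha>..\<beta>})" if "x \<in> {\<alpha>..\<beta>}" for x
      by (rule has_field_derivative_at_within[OF dW]) (use that \<alpha>' in auto)
  qed (rule that[OF \<alpha>'(1) \<alpha>'(2)[unfolded c_def], folded f_def])
qed

section \<open>Singular solutions on hyperbolic space\<close>

lemma Liminf_le_frequently:
  fixes X :: "'a \<Rightarrow> 'b::complete_linorder"
  assumes "\<exists>\<^sub>F x in F. X x \<le> C"
  shows "Liminf F X \<le> C"
proof (rule ccontr)
  assume "\<not> Liminf F X \<le> C"
  then have "\<forall>\<^sub>F x in F. X x > C" by (intro less_LiminfD) simp
  then show False using assms by (simp add: frequently_def not_le)
qed

lemma Limsup_ge_frequently:
  fixes X :: "'a \<Rightarrow> 'b::complete_linorder"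
  assumes "\<exists>\<^sub>F x in F. C \<le> X x"
  shows "C \<le> Limsup F X"
proof (rule ccontr)
  assume "\<not> C \<le> Limsup F X"
  then have "\<forall>\<^sub>F x in F. X x < C" by (intro Limsup_lessD) simp
  then show False using assms by (simp add: frequently_def not_le)
qed

text \<open>
  The scaled solution \<open>sinh r powr m * u r\<close> is the Fowler orbit itself, so its extreme values at the
  singularity are the turning points \<open>\<alpha>\<close> and \<open>\<beta>\<close> of the orbit, whereas its limit at infinity is the
  initial value \<open>\<beta>\<close>. Having the upper limit exactly makes it usable as a parameter that tells the
  solutions apart.
\<close>

theorem oscillating_singular_solution:
  fixes m :: real
  assumes m: "m > 0" and N: "real N = 2 * m + 2" and p: "p = 1 + 2 / m" and lam: "lam = m * (m + 1)"
    and \<beta>: "m powr m < \<beta>" "\<beta> < (m * (m + 1)) powr (m / 2)"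
  obtains u where "positive_radial_singular_solution N lam p u"
    and "0 < Liminf (at_right 0) (\<lambda>r. ereal (sinh r powr m * u r))"
    and "Liminf (at_right 0) (\<lambda>r. ereal (sinh r powr m * u r)) < ereal (m powr m)"
    and "Limsup (at_right 0) (\<lambda>r. ereal (sinh r powr m * u r)) = ereal \<beta>"
    and "u \<sim>[at_top] (\<lambda>r. (2 powr m * \<beta>) * exp (- m * r))"
proof -
  obtain \<alpha> v v' where \<alpha>: "0 < \<alpha>" "\<alpha> < m powr m" and v0: "v 0 = \<beta>"
    and dv: "\<And>t. t \<ge> 0 \<Longrightarrow> (v has_real_derivative v' t) (at t within {0..})"
    and dv': "\<And>t. t \<ge> 0 \<Longrightarrow>
      (v' has_real_derivative m\<^sup>2 * v t - v t powr (1 + 2 / m)) (at t within {0..})"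
    and range: "\<And>t. t \<ge> 0 \<Longrightarrow> v t \<in> {\<alpha>..\<beta>}"
    and hits: "\<And>T. \<exists>t\<ge>T. v t = \<alpha>" "\<And>T. \<exists>t\<ge>T. v t = \<beta>"
    by (rule fowler_oscillation[OF m \<beta>]) blast
  have "(v \<longlongrightarrow> v 0) (at 0 within {0..})"
    using DERIV_continuous[OF dv[of 0]] by (simp add: continuous_within)
  then have lim: "(v \<longlongrightarrow> \<beta>) (at_right 0)"
    unfolding v0 by (rule tendsto_within_subset) auto
  have pos: "\<forall>\<^sub>F r :: real in at_right 0. r > 0" by (rule eventually_at_right_less)
  have scaled: "sinh r powr m * conformal_lift m v r \<in> {\<alpha>..\<beta>}" if "r > 0" for r
    using range[of "cyl r"] cyl_pos[OF that] sinh_powr_times_conformal_lift[OF that] by simp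
  have freq: "\<exists>\<^sub>F r in at_right 0. sinh r powr m * conformal_lift m v r = \<gamma>"
    if "\<And>T. \<exists>t\<ge>T. v t = \<gamma>" for \<gamma>
  proof (rule frequently_rev_mp[OF frequently_cyl[OF that]])
    show "\<forall>\<^sub>F r in at_right 0. v (cyl r) = \<gamma> \<longrightarrow> sinh r powr m * conformal_lift m v r = \<gamma>"
      using pos by eventually_elim (simp add: sinh_powr_times_conformal_lift)
  qed
  show ?thesis
  proof (rule that[of "conformal_lift m v"])
    show "positive_radial_singular_solution N lam p (conformal_lift m v)"
    proof (rule conformal_lift_solves_radial_equation[OF m N p lam, of v v' \<alpha>])
      show "(v has_real_derivative v' t) (at t)" if "t > 0" for t
        using dv[of t] at_within_atLeast_interior[OF that] that by simp
      show "(v' has_real_derivative m\<^sup>2 * v t - v t powr p) (at t)" if "t > 0" for t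
        using dv'[of t] at_within_atLeast_interior[OF that] that by (simp add: p)
    qed (use \<alpha> range in auto)
    have "ereal \<alpha> \<le> Liminf (at_right 0) (\<lambda>r. ereal (sinh r powr m * conformal_lift m v r))"
      by (rule Liminf_bounded) (use pos scaled in \<open>auto elim: eventually_mono\<close>)
    moreover have "Liminf (at_right 0) (\<lambda>r. ereal (sinh r powr m * conformal_lift m v r)) \<le> ereal \<alpha>"
      by (rule Liminf_le_frequently) (rule frequently_elim1[OF freq[OF hits(1)]], simp)
    ultimately have "Liminf (at_right 0) (\<lambda>r. ereal (sinh r powr m * conformal_lift m v r)) = ereal \<alpha>"
      by (rule antisym[rotated])
    then show "0 < Liminf (at_right 0) (\<lambda>r. ereal (sinh r powr m * conformal_lift m v r))"
      and "Liminf (at_right 0) (\<lambda>r. ereal (sinh r powr m * conformal_lift m v r)) < ereal (m powr m)"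
      using \<alpha> by simp_all
    show "Limsup (at_right 0) (\<lambda>r. ereal (sinh r powr m * conformal_lift m v r)) = ereal \<beta>"
    proof (rule antisym)
      show "Limsup (at_right 0) (\<lambda>r. ereal (sinh r powr m * conformal_lift m v r)) \<le> ereal \<beta>"
        by (rule Limsup_bounded) (use pos scaled in \<open>auto elim: eventually_mono\<close>)
      show "ereal \<beta> \<le> Limsup (at_right 0) (\<lambda>r. ereal (sinh r powr m * conformal_lift m v r))"
        by (rule Limsup_ge_frequently) (rule frequently_elim1[OF freq[OF hits(2)]], simp)
    qed
    show "conformal_lift m v \<sim>[at_top] (\<lambda>r. (2 powr m * \<beta>) * exp (- m * r))"
      by (rule conformal_lift_asymp_equiv[OF lim]) (use \<alpha> \<beta> in linarith)
  qed
qed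

text \<open>
  The explicit solution \<open>U_s\<close> is the lift of the equilibrium. The family is obtained by letting the
  amplitude \<open>\<beta>\<close> run through all values between the equilibrium and the homoclinic amplitude.
\<close>

theorem theorem1p2:
  fixes N :: nat and p lam :: real
  assumes "N \<ge> 3"
    and "p = (real N + 2) / (real N - 2)"
    and "lam = real N * (real N - 2) / 4"
  shows "positive_radial_singular_solution N lam p (U_s N) \<and>
    (\<exists>u :: real \<Rightarrow> real \<Rightarrow> real.
       (\<forall>s t. s \<noteq> t \<longrightarrow> (\<exists>r>0. u s r \<noteq> u t r)) \<and>
       (\<forall>s.
          positive_radial_singular_solution N lam p (u s) \<and>
          0 < Liminf (at_right 0) (\<lambda>r. ereal (sinh r powr ((real N - 2) / 2) * u s r)) \<and>
          Liminf (at_right 0) (\<lambda>r. ereal (sinh r powr ((real N - 2) / 2) * u s r)) < ereal (v0 N) \<and>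
          ereal (v0 N) < Limsup (at_right 0) (\<lambda>r. ereal (sinh r powr ((real N - 2) / 2) * u s r)) \<and>
          Limsup (at_right 0) (\<lambda>r. ereal (sinh r powr ((real N - 2) / 2) * u s r))
            < ereal ((real N * (real N - 2) / 4) powr ((real N - 2) / 4)) \<and>
          (\<exists>ubar > 0. u s \<sim>[at_top] (\<lambda>r. ubar * exp ((2 - real N) / 2 * r)))))"
proof -
  define m where "m = (real N - 2) / 2"
  have m: "m > 0" and N: "real N = 2 * m + 2" using assms(1) by (auto simp: m_def field_simps)
  have p: "p = 1 + 2 / m" unfolding assms(2) N using m by (simp add: field_simps)
  have lam: "lam = m * (m + 1)" unfolding assms(3) N by (simp add: field_simps)
  have v0: "v0 N = m powr m" by (simp add: v0_def m_def)
  define B where "B = (m * (m + 1)) powr (m / 2)"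
  have B: "(real N * (real N - 2) / 4) powr ((real N - 2) / 4) = B"
  proof -
    have "real N * (real N - 2) / 4 = m * (m + 1)" "(real N - 2) / 4 = m / 2"
      by (simp_all add: N field_simps)
    then show ?thesis by (simp only: B_def)
  qed
  have decay: "(2 - real N) / 2 = - m" by (simp add: N)
  have "m powr m = (m * m) powr (m / 2)" using m by (simp add: powr_mult flip: powr_add)
  also have "\<dots> < B" unfolding B_def using m by (intro powr_less_mono2) auto
  finally have cB: "m powr m < B" .

  have "U_s N = conformal_lift m (\<lambda>_. m powr m)"
  proof
    fix r
    have "U_s N r = (m / sinh r) powr m" by (simp add: U_s_def m_def)
    then show "U_s N r = conformal_lift m (\<lambda>_. m powr m) r"
      by (simp add: conformal_lift_def powr_divide powr_minus_divide)
  qed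
  moreover have "positive_radial_singular_solution N lam p (conformal_lift m (\<lambda>_. m powr m))"
  proof (rule conformal_lift_solves_radial_equation[OF m N p lam, of _ "\<lambda>_. 0" "m powr m"])
    have "m * p = 2 + m" using m by (simp add: p field_simps)
    then have "m\<^sup>2 * m powr m - (m powr m) powr p = 0"
      using m by (simp add: powr_powr powr_add powr_numeral)
    then show "((\<lambda>_. 0) has_real_derivative m\<^sup>2 * m powr m - (m powr m) powr p) (at t)" for t
      by simp
  qed (use m in auto)
  ultimately have "positive_radial_singular_solution N lam p (U_s N)" by simp

  \<comment> \<open>A logistic curve parametrizes the interval of admissible amplitudes injectively by the real line.\<close>
  define a where "a s = m powr m + (B - m powr m) / (1 + exp s)" for s :: real
  have denom: "1 + exp s > 1" for s :: real by simp
  have a: "m powr m < a s" "a s < B" for s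
  proof -
    have "(B - m powr m) / (1 + exp s) > 0" using cB denom[of s] by (intro divide_pos_pos) linarith+
    moreover have "(B - m powr m) / (1 + exp s) < (B - m powr m) / 1"
      using cB denom[of s] by (intro divide_strict_left_mono) (auto simp: add_pos_pos)
    ultimately show "m powr m < a s" "a s < B" by (auto simp: a_def)
  qed
  have a_inj: "s = t" if "a s = a t" for s t
    using that cB by (simp add: a_def)
  define good where "good \<beta> u \<longleftrightarrow> positive_radial_singular_solution N lam p u \<and>
    0 < Liminf (at_right 0) (\<lambda>r. ereal (sinh r powr m * u r)) \<and>
    Liminf (at_right 0) (\<lambda>r. ereal (sinh r powr m * u r)) < ereal (m powr m) \<and>
    Limsup (at_right 0) (\<lambda>r. ereal (sinh r powr m * u r)) = ereal \<beta> \<and>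
    u \<sim>[at_top] (\<lambda>r. (2 powr m * \<beta>) * exp (- m * r))" for \<beta> u
  have "\<exists>u. good (a s) u" for s
    by (rule oscillating_singular_solution[OF m N p lam a(1)[of s] a(2)[of s, unfolded B_def]])
       (auto simp: good_def)
  then obtain u where u: "\<And>s. good (a s) (u s)" by metis
  have "\<exists>r>0. u s r \<noteq> u t r" if "s \<noteq> t" for s t
  proof (rule ccontr)
    assume "\<not> ?thesis"
    then have same: "u s r = u t r" if "r > 0" for r using that by blast
    have "Limsup (at_right 0) (\<lambda>r. ereal (sinh r powr m * u s r))
        = Limsup (at_right 0) (\<lambda>r. ereal (sinh r powr m * u t r))"
      by (rule Limsup_eq) (use eventually_at_right_less[of "0::real"] in eventually_elim, simp add: same)
    then have "a s = a t" using u[of s] u[of t] by (simp add: good_def)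
    then show False using a_inj that by blast
  qed
  moreover have "\<exists>ubar>0. u s \<sim>[at_top] (\<lambda>r. ubar * exp (- m * r))" for s
  proof -
    have "a s > 0" using a(1)[of s] powr_ge_zero[of m m] by linarith
    then show ?thesis using u[of s] by (intro exI[of _ "2 powr m * a s"]) (auto simp: good_def)
  qed
  ultimately have "\<exists>u :: real \<Rightarrow> real \<Rightarrow> real.
       (\<forall>s t. s \<noteq> t \<longrightarrow> (\<exists>r>0. u s r \<noteq> u t r)) \<and>
       (\<forall>s.
          positive_radial_singular_solution N lam p (u s) \<and>
          0 < Liminf (at_right 0) (\<lambda>r. ereal (sinh r powr m * u s r)) \<and>
          Liminf (at_right 0) (\<lambda>r. ereal (sinh r powr m * u s r)) < ereal (m powr m) \<and>
          ereal (m powr m) < Limsup (at_right 0) (\<lambda>r. ereal (sinh r powr m * u s r)) \<and>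
          Limsup (at_right 0) (\<lambda>r. ereal (sinh r powr m * u s r)) < ereal B \<and>
          (\<exists>ubar > 0. u s \<sim>[at_top] (\<lambda>r. ubar * exp (- m * r))))"
    using u a unfolding good_def by (intro exI[of _ u]) auto
  with \<open>positive_radial_singular_solution N lam p (U_s N)\<close> show ?thesis
    unfolding v0 B decay m_def[symmetric] by (rule conjI)
qed

end
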